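(* Let $M$ be a connected surface and let $\vec{\mathcal H}(M)=\bigcup_{k\ge0}\vec{\mathcal H}_k(M)$ be a hyperdigraph on $M$ with its underlying hypergraph $\mathcal H(M)=\bigcup_{k\ge0}\mathcal H_k(M)$. There are graded homomorphisms $$\Pi_1(\vec{\mathcal H}_\bullet(M))\to\mathcal B_\bullet(M),\qquad \Pi_1(\mathcal H_\bullet(M))\to\mathcal P_\bullet(M)$$ such that the following diagram commutes: $$\begin{array}{ccc}\Pi_1(\vec{\mathcal H}_\bullet(M))&\to&\mathcal B_\bullet(M)\\ \downarrow{\scriptstyle\pi_*}&&\downarrow{\scriptstyle\pi_*}\\ \Pi_1(\mathcal H_\bullet(M))&\to&\mathcal P_\bullet(M).\end{array}$$
   Context: $\mathrm{Conf}_k(M)$ is the space of ordered $k$-tuples of distinct points of $M$; $\mathrm{Conf}_k(M)/\Sigma_k$ is its orbit space under the coordinate-permuting action of the symmetric group $\Sigma_k$; $\pi:\mathrm{Conf}_k(M)\to\mathrm{Conf}_k(M)/\Sigma_k$ is the canonical projection. A hyperdigraph on $M$ is a union $\bigcup_{k\ge0}\vec{\mathcal H}_k(M)$ where $\vec{\mathcal H}_k(M)$ is a submanifold of $\mathrm{Conf}_k(M)$; its underlying hypergraph has $\mathcal H_k(M)=\pi(\vec{\mathcal H}_k(M))\subseteq\mathrm{Conf}_k(M)/\Sigma_k$. $\Pi_1$ is the fundamental groupoid. In the terminology used here, the braid groupoid is $\mathcal B_k(M)=\Pi_1(\mathrm{Conf}_k(M))$ and the pure braid groupoid is $\mathcal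 P_k(M)=\Pi_1(\mathrm{Conf}_k(M)/\Sigma_k)$. The index $\bullet$ denotes the family indexed by $k\ge1$, and $\pi_*$ denotes the homomorphisms of groupoids induced by $\pi$. *)

theory Defs
  imports "HOL-Analysis.Analysis" "HOL-Combinatorics.Permutations"
begin

subsection \<open>Manifolds\<close>

definition topological_manifold :: "nat \<Rightarrow> 'a topology \<Rightarrow> bool" where
  "topological_manifold n X \<longleftrightarrow>
     Hausdorff_space X \<and> second_countable X \<and>
     (\<forall>x \<in> topspace X. \<exists>U V. openin X U \<and> x \<in> U \<and> openin (Euclidean_space n) V \<and>
        subtopology X U homeomorphic_space subtopology (Euclidean_space n) V)"

abbreviation surface :: "'a topology \<Rightarrow> bool" where
  "surface \<equiv> topological_manifold 2"

text \<open>
  Embedded submanifolds, of any dimension and without boundary, in the topological category.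
  The empty set is a submanifold.  Local flatness is not required, so that smooth and locally
  flat submanifolds are included.
\<close>

definition submanifold :: "'a topology \<Rightarrow> 'a set \<Rightarrow> bool" where
  "submanifold X S \<longleftrightarrow>
     S \<subseteq> topspace X \<and> (\<exists>m. topological_manifold m (subtopology X S))"


subsection \<open>Quotient topology\<close>

definition quotient_topology :: "'a topology \<Rightarrow> ('a \<Rightarrow> 'b) \<Rightarrow> 'b topology" where
  "quotient_topology X f =
     topology (\<lambda>U. U \<subseteq> f ` topspace X \<and> openin X {x \<in> topspace X. f x \<in> U})"

lemma openin_quotient_topology:
  "openin (quotient_topology X f) U \<longleftrightarrow>
     U \<subseteq> f ` topspace X \<and> openin X {x \<in> topspace X. f x \<in> U}"
proof -
  let ?P = "\<lambda>U. U \<subseteq> f ` topspace X \<and> openin X {x \<in> topspace X. f x \<in> U}"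
  have "istopology ?P"
    unfolding istopology_def
  proof (intro conjI allI impI)
    fix S T assume S: "?P S" and T: "?P T"
    show "S \<inter> T \<subseteq> f ` topspace X" using S by blast
    have "{x \<in> topspace X. f x \<in> S \<inter> T}
            = {x \<in> topspace X. f x \<in> S} \<inter> {x \<in> topspace X. f x \<in> T}" by blast
    then show "openin X {x \<in> topspace X. f x \<in> S \<inter> T}"
      using S T by (simp add: openin_Int)
  next
    fix K assume K: "\<forall>S\<in>K. ?P S"
    show "\<Union>K \<subseteq> f ` topspace X" using K by blast
    have "{x \<in> topspace X. f x \<in> \<Union>K} = (\<Union>S\<in>K. {x \<in> topspace X. f x \<in> S})" by blast
    moreover have "openin X (\<Union>S\<in>K. {x \<in> topspace X. f x \<in> S})"
      using K by (blast intro: openin_Union)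
    ultimately show "openin X {x \<in> topspace X. f x \<in> \<Union>K}" by simp
  qed
  then show ?thesis
    by (simp add: quotient_topology_def topology_inverse')
qed

lemma topspace_quotient_topology [simp]: "topspace (quotient_topology X f) = f ` topspace X"
proof
  show "topspace (quotient_topology X f) \<subseteq> f ` topspace X"
    by (meson openin_quotient_topology openin_topspace)
  have "{x \<in> topspace X. f x \<in> f ` topspace X} = topspace X" by blast
  then have "openin (quotient_topology X f) (f ` topspace X)"
    by (simp add: openin_quotient_topology)
  then show "f ` topspace X \<subseteq> topspace (quotient_topology X f)"
    by (rule openin_subset)
qed

lemma quotient_map_quotient_topology: "quotient_map X (quotient_topology X f) f"
  unfolding quotient_map_def by (auto simp: openin_quotient_topology)


subsection \<open>Configuration spaces and hyperdigraphs\<close>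

text \<open>
  An ordered \<open>k\<close>-tuple is an extensional function on \<open>{..<k}\<close>; the configuration space has the
  subspace topology of the \<open>k\<close>-fold product.
\<close>

definition conf_space :: "'a topology \<Rightarrow> nat \<Rightarrow> (nat \<Rightarrow> 'a) topology" where
  "conf_space M k = subtopology (product_topology (\<lambda>_. M) {..<k}) {x. inj_on x {..<k}}"

definition conf_proj :: "nat \<Rightarrow> (nat \<Rightarrow> 'a) \<Rightarrow> (nat \<Rightarrow> 'a) set" where
  "conf_proj k x = {x \<circ> \<sigma> |\<sigma>. \<sigma> permutes {..<k}}"

definition unordered_conf_space :: "'a topology \<Rightarrow> nat \<Rightarrow> (nat \<Rightarrow> 'a) set topology" where
  "unordered_conf_space M k = quotient_topology (conf_space M k) (conf_proj k)"

text \<open>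
  The union over \<open>k\<close> is kept as a family: its members consist of tuples of different lengths,
  but as extensional functions such tuples need not be distinct.
\<close>

definition hyperdigraph :: "'a topology \<Rightarrow> (nat \<Rightarrow> (nat \<Rightarrow> 'a) set) \<Rightarrow> bool" where
  "hyperdigraph M H \<longleftrightarrow> (\<forall>k. submanifold (conf_space M k) (H k))"

definition underlying_hypergraph ::
    "(nat \<Rightarrow> (nat \<Rightarrow> 'a) set) \<Rightarrow> nat \<Rightarrow> (nat \<Rightarrow> 'a) set set" where
  "underlying_hypergraph H k = conf_proj k ` H k"

definition hyperdigraph_space ::
    "'a topology \<Rightarrow> (nat \<Rightarrow> (nat \<Rightarrow> 'a) set) \<Rightarrow> nat \<Rightarrow> (nat \<Rightarrow> 'a) topology" where
  "hyperdigraph_space M H k = subtopology (conf_space M k) (H k)"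

text \<open>
  Since \<open>H k\<close> need not be invariant under permutations, this subspace topology may be strictly
  coarser than the quotient topology induced from \<open>H k\<close>.
\<close>

definition hypergraph_space ::
    "'a topology \<Rightarrow> (nat \<Rightarrow> (nat \<Rightarrow> 'a) set) \<Rightarrow> nat \<Rightarrow> (nat \<Rightarrow> 'a) set topology" where
  "hypergraph_space M H k =
     subtopology (unordered_conf_space M k) (underlying_hypergraph H k)"


subsection \<open>Groupoids and their homomorphisms\<close>

text \<open>Composition is in diagrammatic order: \<open>comp_arr G a b\<close> is first \<open>a\<close>, then \<open>b\<close>.\<close>

record ('o, 'm) groupoid =
  objs :: "'o set"
  arrows :: "'o \<Rightarrow> 'o \<Rightarrow> 'm set"
  ident :: "'o \<Rightarrow> 'm"
  comp_arr :: "'m \<Rightarrow> 'm \<Rightarrow> 'm"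

definition is_groupoid :: "('o, 'm) groupoid \<Rightarrow> bool" where
  "is_groupoid G \<longleftrightarrow>
     (\<forall>x \<in> objs G. \<forall>y \<in> objs G. \<forall>x' \<in> objs G. \<forall>y' \<in> objs G.
        arrows G x y \<inter> arrows G x' y' \<noteq> {} \<longrightarrow> x = x' \<and> y = y') \<and>
     (\<forall>x \<in> objs G. ident G x \<in> arrows G x x) \<and>
     (\<forall>x \<in> objs G. \<forall>y \<in> objs G. \<forall>z \<in> objs G. \<forall>a \<in> arrows G x y. \<forall>b \<in> arrows G y z.
        comp_arr G a b \<in> arrows G x z) \<and>
     (\<forall>x \<in> objs G. \<forall>y \<in> objs G. \<forall>a \<in> arrows G x y.
        comp_arr G (ident G x) a = a \<and> comp_arr G a (ident G y) = a) \<and>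
     (\<forall>w \<in> objs G. \<forall>x \<in> objs G. \<forall>y \<in> objs G. \<forall>z \<in> objs G.
        \<forall>a \<in> arrows G w x. \<forall>b \<in> arrows G x y. \<forall>c \<in> arrows G y z.
          comp_arr G (comp_arr G a b) c = comp_arr G a (comp_arr G b c)) \<and>
     (\<forall>x \<in> objs G. \<forall>y \<in> objs G. \<forall>a \<in> arrows G x y.
        \<exists>b \<in> arrows G y x. comp_arr G a b = ident G x \<and> comp_arr G b a = ident G y)"

record ('o, 'm, 'p, 'n) groupoid_map =
  on_objs :: "'o \<Rightarrow> 'p"
  on_arrows :: "'m \<Rightarrow> 'n"

definition groupoid_hom ::
    "('o, 'm) groupoid \<Rightarrow> ('p, 'n) groupoid \<Rightarrow> ('o, 'm, 'p, 'n) groupoid_map \<Rightarrow> bool" where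
  "groupoid_hom G G' F \<longleftrightarrow>
     is_groupoid G \<and> is_groupoid G' \<and>
     (\<forall>x \<in> objs G. on_objs F x \<in> objs G') \<and>
     (\<forall>x \<in> objs G. \<forall>y \<in> objs G. \<forall>a \<in> arrows G x y.
        on_arrows F a \<in> arrows G' (on_objs F x) (on_objs F y)) \<and>
     (\<forall>x \<in> objs G. on_arrows F (ident G x) = ident G' (on_objs F x)) \<and>
     (\<forall>x \<in> objs G. \<forall>y \<in> objs G. \<forall>z \<in> objs G. \<forall>a \<in> arrows G x y. \<forall>b \<in> arrows G y z.
        on_arrows F (comp_arr G a b) = comp_arr G' (on_arrows F a) (on_arrows F b))"

definition groupoid_map_comp ::
    "('p, 'n, 'q, 'l) groupoid_map \<Rightarrow> ('o, 'm, 'p, 'n) groupoid_map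
       \<Rightarrow> ('o, 'm, 'q, 'l) groupoid_map" where
  "groupoid_map_comp F' F =
     \<lparr>on_objs = on_objs F' \<circ> on_objs F, on_arrows = on_arrows F' \<circ> on_arrows F\<rparr>"

definition groupoid_map_eq_on ::
    "('o, 'm) groupoid \<Rightarrow> ('o, 'm, 'p, 'n) groupoid_map
       \<Rightarrow> ('o, 'm, 'p, 'n) groupoid_map \<Rightarrow> bool" where
  "groupoid_map_eq_on G F F' \<longleftrightarrow>
     (\<forall>x \<in> objs G. on_objs F x = on_objs F' x) \<and>
     (\<forall>x \<in> objs G. \<forall>y \<in> objs G. \<forall>a \<in> arrows G x y. on_arrows F a = on_arrows F' a)"

text \<open>Graded objects are families indexed by \<open>k \<ge> 1\<close>.\<close>

definition graded_groupoid_hom ::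
    "(nat \<Rightarrow> ('o, 'm) groupoid) \<Rightarrow> (nat \<Rightarrow> ('p, 'n) groupoid)
       \<Rightarrow> (nat \<Rightarrow> ('o, 'm, 'p, 'n) groupoid_map) \<Rightarrow> bool" where
  "graded_groupoid_hom G G' F \<longleftrightarrow> (\<forall>k\<ge>1. groupoid_hom (G k) (G' k) (F k))"


subsection \<open>The fundamental groupoid\<close>

text \<open>
  The path operations of the library are restricted to topological spaces given by a type class,
  so they are restated for abstract topologies.  Only the values on \<open>{0..1}\<close> of a path matter.
\<close>

definition path_homotopic :: "'a topology \<Rightarrow> (real \<Rightarrow> 'a) \<Rightarrow> (real \<Rightarrow> 'a) \<Rightarrow> bool" where
  "path_homotopic X p q \<longleftrightarrow>
     homotopic_with (\<lambda>r. r 0 = p 0 \<and> r 1 = p 1) (top_of_set {0..1}) X p q"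

definition path_class :: "'a topology \<Rightarrow> (real \<Rightarrow> 'a) \<Rightarrow> (real \<Rightarrow> 'a) set" where
  "path_class X p = {q. path_homotopic X p q}"

definition path_concat :: "(real \<Rightarrow> 'a) \<Rightarrow> (real \<Rightarrow> 'a) \<Rightarrow> real \<Rightarrow> 'a" where
  "path_concat p q = (\<lambda>t. if t \<le> 1/2 then p (2 * t) else q (2 * t - 1))"

text \<open>
  Composition and induced maps are written as unions over all representatives; all members of
  the union are the same class.
\<close>

definition fundamental_groupoid :: "'a topology \<Rightarrow> ('a, (real \<Rightarrow> 'a) set) groupoid" where
  "fundamental_groupoid X =
     \<lparr>objs = topspace X,
      arrows = (\<lambda>x y. {path_class X p |p. pathin X p \<and> p 0 = x \<and> p 1 = y}),
      ident = (\<lambda>x. path_class X (\<lambda>_. x)),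
      comp_arr = (\<lambda>a b. \<Union>p\<in>a. \<Union>q\<in>b. path_class X (path_concat p q))\<rparr>"

definition induced_map ::
    "'b topology \<Rightarrow> ('a \<Rightarrow> 'b) \<Rightarrow> ('a, (real \<Rightarrow> 'a) set, 'b, (real \<Rightarrow> 'b) set) groupoid_map" where
  "induced_map Y f =
     \<lparr>on_objs = f, on_arrows = (\<lambda>a. \<Union>p\<in>a. path_class Y (f \<circ> p))\<rparr>"

text \<open>
  In the terminology used here, the braid groupoid belongs to the ordered and the pure braid
  groupoid to the unordered configurations, opposite to the common convention.
\<close>

definition braid_groupoid ::
    "'a topology \<Rightarrow> nat \<Rightarrow> (nat \<Rightarrow> 'a, (real \<Rightarrow> nat \<Rightarrow> 'a) set) groupoid" where
  "braid_groupoid M k = fundamental_groupoid (conf_space M k)"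

definition pure_braid_groupoid ::
    "'a topology \<Rightarrow> nat \<Rightarrow> ((nat \<Rightarrow> 'a) set, (real \<Rightarrow> (nat \<Rightarrow> 'a) set) set) groupoid" where
  "pure_braid_groupoid M k = fundamental_groupoid (unordered_conf_space M k)"

end

theory Submission
  imports Defs
begin

text \<open>
  A continuous map sends path classes to path classes compatibly with concatenation, so
  \<open>\<Pi>\<^sub>1\<close> is a functor.  Both horizontal maps are induced by inclusions of subspaces, and the
  diagram is the image under \<open>\<Pi>\<^sub>1\<close> of a commutative square of continuous maps.  The groupoid
  laws all come from one fact: two reparametrizations of the same path that agree at the
  endpoints are homotopic, because \<open>{0..1}\<close> is convex.
\<close>

section \<open>Homotopy of paths relative to their endpoints\<close>

abbreviation unit_interval :: "real topology" where
  "unit_interval \<equiv> top_of_set {0..1}"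

text \<open>The first coordinate of \<open>h\<close> is homotopy time, the second the path
  parameter. Agreement with \<open>p\<close> and \<open>q\<close> can be relaxed to
  \<open>{0..1}\<close> because the endpoint condition only looks at 0 and 1, which lie there. Later
  homotopies are built and taken apart in this form.\<close>

lemma path_homotopic_iff:
  "path_homotopic X p q \<longleftrightarrow>
     (\<exists>h. continuous_map (prod_topology unit_interval unit_interval) X h \<and>
        (\<forall>s\<in>{0..1}. h (0, s) = p s) \<and> (\<forall>s\<in>{0..1}. h (1, s) = q s) \<and>
        (\<forall>t\<in>{0..1}. h (t, 0) = p 0 \<and> h (t, 1) = p 1))"
  unfolding path_homotopic_def by (subst homotopic_with) auto

text \<open>Evaluate the homotopy at the corners (1, 0) and (1, 1). The definition fixes the ends
  through \<open>p\<close> alone; moving that condition over to \<open>q\<close> is what makes the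
  relation symmetric and transitive.\<close>

lemma path_homotopic_ends:
  assumes "path_homotopic X p q"
  shows "q 0 = p 0" "q 1 = p 1"
proof -
  obtain h where "continuous_map (prod_topology unit_interval unit_interval) X h"
      "\<forall>s\<in>{0..1}. h (1, s) = q s" "\<forall>t\<in>{0..1}. h (t, 0) = p 0 \<and> h (t, 1) = p 1"
    using assms unfolding path_homotopic_iff by blast
  moreover have "(0::real) \<in> {0..1}" "(1::real) \<in> {0..1}" by auto
  ultimately show "q 0 = p 0" "q 1 = p 1" by metis+
qed

lemma path_homotopic_imp_pathin:
  assumes "path_homotopic X p q"
  shows "pathin X p" "pathin X q"
  using homotopic_with_imp_continuous_maps[OF assms[unfolded path_homotopic_def]]
  by (auto simp: pathin_def)

lemma path_homotopic_refl: "pathin X p \<Longrightarrow> path_homotopic X p p"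
  by (simp add: path_homotopic_def pathin_def)

lemma path_homotopic_sym:
  assumes "path_homotopic X p q"
  shows "path_homotopic X q p"
  using path_homotopic_ends[OF assms] assms
  by (simp add: path_homotopic_def homotopic_with_sym)

lemma path_homotopic_trans [trans]:
  assumes "path_homotopic X p q" "path_homotopic X q r"
  shows "path_homotopic X p r"
  using path_homotopic_ends[OF assms(1)] assms
  by (auto simp: path_homotopic_def intro: homotopic_with_trans)

text \<open>\<open>path_homotopic_iff\<close> evaluates the two paths only on \<open>{0..1}\<close>.
  This is used below to rewrite reparametrized paths as concatenations.\<close>

lemma path_homotopic_cong:
  assumes "path_homotopic X p q"
    and "\<And>s. s \<in> {0..1} \<Longrightarrow> p s = p' s" "\<And>s. s \<in> {0..1} \<Longrightarrow> q s = q' s"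
  shows "path_homotopic X p' q'"
  using assms by (simp add: path_homotopic_iff)

lemma path_homotopic_compose:
  assumes "path_homotopic X p q" "continuous_map X Y f"
  shows "path_homotopic Y (f \<circ> p) (f \<circ> q)"
proof -
  obtain h where "continuous_map (prod_topology unit_interval unit_interval) X h"
      "\<forall>s\<in>{0..1}. h (0, s) = p s" "\<forall>s\<in>{0..1}. h (1, s) = q s"
      "\<forall>t\<in>{0..1}. h (t, 0) = p 0 \<and> h (t, 1) = p 1"
    using assms(1) unfolding path_homotopic_iff by blast
  then show ?thesis
    unfolding path_homotopic_iff
    by (intro exI[of _ "f \<circ> h"]) (auto intro: continuous_map_compose assms(2))
qed

section \<open>Reparametrization and concatenation\<close>

lemma path_homotopic_reparametrize:
  fixes f g :: "real \<Rightarrow> real"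
  assumes p: "pathin X p"
    and f: "continuous_on {0..1} f" "f ` {0..1} \<subseteq> {0..1}"
    and g: "continuous_on {0..1} g" "g ` {0..1} \<subseteq> {0..1}"
    and ends: "f 0 = g 0" "f 1 = g 1"
  shows "path_homotopic X (p \<circ> f) (p \<circ> g)"
proof -
  \<comment> \<open>The straight-line homotopy from \<open>f\<close> to \<open>g\<close>. It is
    constant in time wherever \<open>f\<close> and \<open>g\<close> agree, in particular at 0 and 1,
    so \<open>p \<circ> ?c\<close> fixes the endpoints.\<close>
  let ?c = "\<lambda>z::real \<times> real. (1 - fst z) * f (snd z) + fst z * g (snd z)"
  have "continuous_on ({0..1} \<times> {0..1}) ?c"
    by (intro continuous_intros continuous_on_compose2[OF f(1)] continuous_on_compose2[OF g(1)])
      auto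
  moreover have "?c z \<in> {0..1}" if "z \<in> {0..1} \<times> {0..1}" for z
  proof -
    have "f (snd z) \<in> {0..1}" "g (snd z) \<in> {0..1}" using f(2) g(2) that by auto
    then show ?thesis
      using that convexD[OF convex_real_interval(5)[of 0 1], of "f (snd z)" "g (snd z)"
          "1 - fst z" "fst z"]
      by auto
  qed
  ultimately have "continuous_map (prod_topology unit_interval unit_interval) unit_interval ?c"
    by (auto simp: prod_topology_subtopology subtopology_subtopology euclidean_product_topology
        Times_Int_Times continuous_map_in_subtopology)
  then have "continuous_map (prod_topology unit_interval unit_interval) X (p \<circ> ?c)"
    using p unfolding pathin_def by (rule continuous_map_compose)
  then show ?thesis
    unfolding path_homotopic_iff
    by (intro exI[of _ "p \<circ> ?c"]) (auto simp: ends algebra_simps)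
qed

text \<open>Both homotopies are run at the same time, \<open>h\<close> on the half of the square
  where the path parameter is at most 1/2 and \<open>k\<close> on the other half.\<close>

lemma path_homotopic_concat:
  assumes "path_homotopic X p p'" "path_homotopic X q q'" "p 1 = q 0"
  shows "path_homotopic X (path_concat p q) (path_concat p' q')"
proof -
  let ?I2 = "prod_topology unit_interval unit_interval"
  obtain h where h: "continuous_map ?I2 X h"
      "\<forall>s\<in>{0..1}. h (0, s) = p s" "\<forall>s\<in>{0..1}. h (1, s) = p' s"
      "\<forall>t\<in>{0..1}. h (t, 0) = p 0 \<and> h (t, 1) = p 1"
    using assms(1) unfolding path_homotopic_iff by blast
  obtain k where k: "continuous_map ?I2 X k"
      "\<forall>s\<in>{0..1}. k (0, s) = q s" "\<forall>s\<in>{0..1}. k (1, s) = q' s"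
      "\<forall>t\<in>{0..1}. k (t, 0) = q 0 \<and> k (t, 1) = q 1"
    using assms(2) unfolding path_homotopic_iff by blast
  \<comment> \<open>\<open>?a\<close> and \<open>?b\<close> stretch the two halves of the unit
    square onto the whole square, in the path parameter only.\<close>
  let ?a = "\<lambda>z::real \<times> real. (fst z, 2 * snd z)"
  let ?b = "\<lambda>z::real \<times> real. (fst z, 2 * snd z - 1)"
  have I2: "?I2 = top_of_set ({0..1} \<times> {0..1})"
    by (simp add: prod_topology_subtopology subtopology_subtopology euclidean_product_topology
        Times_Int_Times)
  have a: "continuous_map (subtopology ?I2 {z \<in> topspace ?I2. snd z \<le> 1/2}) ?I2 ?a"
    unfolding I2 by (auto simp: subtopology_subtopology intro!: continuous_intros)
  have b: "continuous_map (subtopology ?I2 {z \<in> topspace ?I2. 1/2 \<le> snd z}) ?I2 ?b"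
    unfolding I2 by (auto simp: subtopology_subtopology intro!: continuous_intros)
  have "continuous_map ?I2 X (\<lambda>z. if snd z \<le> 1/2 then (h \<circ> ?a) z else (k \<circ> ?b) z)"
  proof (rule continuous_map_cases_le)
    show "continuous_map ?I2 euclideanreal snd"
      unfolding I2 by (auto intro!: continuous_intros)
    show "continuous_map (subtopology ?I2 {z \<in> topspace ?I2. snd z \<le> 1/2}) X (h \<circ> ?a)"
      using a h(1) by (rule continuous_map_compose)
    show "continuous_map (subtopology ?I2 {z \<in> topspace ?I2. 1/2 \<le> snd z}) X (k \<circ> ?b)"
      using b k(1) by (rule continuous_map_compose)
    \<comment> \<open>On the seam \<open>h\<close> is constantly \<open>p 1\<close> and
      \<open>k\<close> constantly \<open>q 0\<close>, since each homotopy fixes its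
      endpoints.\<close>
    show "(h \<circ> ?a) z = (k \<circ> ?b) z" if z: "z \<in> topspace ?I2" "snd z = 1/2" for z
    proof -
      obtain t where "z = (t, 1/2)" "t \<in> {0..1}" using z by (cases z) auto
      then show ?thesis using h(4) k(4) assms(3) by simp
    qed
  qed simp
  then show ?thesis
    unfolding path_homotopic_iff
    by (intro exI[of _ "\<lambda>z. if snd z \<le> 1/2 then (h \<circ> ?a) z else (k \<circ> ?b) z"] conjI)
      (use h k in \<open>auto simp: path_concat_def\<close>)
qed

text \<open>The gluing in \<open>path_homotopic_concat\<close>, applied to the trivial homotopies of
  \<open>p\<close> and \<open>q\<close>, already contains the continuity of the
  concatenation.\<close>

lemma pathin_concat:
  assumes "pathin X p" "pathin X q" "p 1 = q 0"
  shows "pathin X (path_concat p q)"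
  using path_homotopic_concat[OF path_homotopic_refl path_homotopic_refl, OF assms]
  by (rule path_homotopic_imp_pathin)

lemma path_concat_ends [simp]:
  "path_concat p q 0 = p 0" "path_concat p q 1 = q 1"
  by (simp_all add: path_concat_def)

lemma compose_path_concat: "f \<circ> path_concat p q = path_concat (f \<circ> p) (f \<circ> q)"
  by (auto simp: path_concat_def)

section \<open>The groupoid laws up to homotopy\<close>

lemma path_homotopic_concat_const_left:
  assumes "pathin X p"
  shows "path_homotopic X (path_concat (\<lambda>_. p 0) p) p"
proof -
  \<comment> \<open>This parameter change waits at 0 until 1/2 and then runs at double speed; the
    right unit law waits at 1 instead.\<close>
  have "path_homotopic X (p \<circ> (\<lambda>s. max (2 * s - 1) 0)) (p \<circ> (\<lambda>s. s))"
    by (rule path_homotopic_reparametrize[OF assms]) (auto intro!: continuous_intros)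
  then show ?thesis
    by (rule path_homotopic_cong) (auto simp: path_concat_def max_def)
qed

lemma path_homotopic_concat_const_right:
  assumes "pathin X p"
  shows "path_homotopic X (path_concat p (\<lambda>_. p 1)) p"
proof -
  have "path_homotopic X (p \<circ> (\<lambda>s. min (2 * s) 1)) (p \<circ> (\<lambda>s. s))"
    by (rule path_homotopic_reparametrize[OF assms]) (auto intro!: continuous_intros)
  then show ?thesis
    by (rule path_homotopic_cong) (auto simp: path_concat_def min_def)
qed

lemma path_homotopic_concat_assoc:
  assumes "pathin X p" "pathin X q" "pathin X r" "p 1 = q 0" "q 1 = r 0"
  shows "path_homotopic X (path_concat (path_concat p q) r) (path_concat p (path_concat q r))"
proof -
  \<comment> \<open>The piecewise linear map sending 0, 1/4, 1/2, 1 to 0, 1/2, 3/4, 1, that is, the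
    break points of \<open>(p q) r\<close> to those of \<open>p (q r)\<close>. Its slopes 2, 1, 1/2
    decrease, so it is the minimum of its three linear pieces.\<close>
  let ?f = "\<lambda>s::real. min (2 * s) (min (s + 1/4) (s / 2 + 1/2))"
  have "continuous_on {0..1} ?f"
    by (intro continuous_intros) auto
  then have "path_homotopic X (path_concat p (path_concat q r) \<circ> ?f)
      (path_concat p (path_concat q r) \<circ> (\<lambda>s. s))"
    by (intro path_homotopic_reparametrize pathin_concat) (use assms in auto)
  then show ?thesis
    by (rule path_homotopic_cong) (auto simp: path_concat_def min_def field_simps
        intro!: arg_cong[of _ _ q] arg_cong[of _ _ r])
qed

lemma path_homotopic_concat_reverse:
  assumes "pathin X p"
  shows "path_homotopic X (path_concat p (\<lambda>s. p (1 - s))) (\<lambda>_. p 0)"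
proof -
  \<comment> \<open>Going along \<open>p\<close> and back is \<open>p\<close> after the tent map,
    which vanishes at both ends and so can be contracted to the constant 0.\<close>
  have "path_homotopic X (p \<circ> (\<lambda>s. min (2 * s) (2 - 2 * s))) (p \<circ> (\<lambda>_. 0))"
    by (rule path_homotopic_reparametrize[OF assms]) (auto intro!: continuous_intros)
  then show ?thesis
    by (rule path_homotopic_cong) (auto simp: path_concat_def min_def algebra_simps)
qed

lemma pathin_reverse:
  assumes "pathin X p"
  shows "pathin X (\<lambda>s. p (1 - s))"
proof -
  have "continuous_map unit_interval unit_interval (\<lambda>s. 1 - s)"
    by (auto intro!: continuous_intros)
  then have "continuous_map unit_interval X (p \<circ> (\<lambda>s. 1 - s))"
    using assms unfolding pathin_def by (rule continuous_map_compose)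
  then show ?thesis by (simp add: pathin_def o_def)
qed

section \<open>Path classes, composition and induced maps on representatives\<close>

lemma path_class_eqI:
  assumes "path_homotopic X p q"
  shows "path_class X p = path_class X q"
  unfolding path_class_def
  using assms path_homotopic_sym path_homotopic_trans by blast

text \<open>Homotopy is reflexive only on continuous paths; any other function has an empty class.
  Nonemptiness is what lets the unions over representatives collapse below.\<close>

lemma path_class_self: "pathin X p \<Longrightarrow> p \<in> path_class X p"
  by (simp add: path_class_def path_homotopic_refl)

text \<open>Endpoints are invariants of the class; this yields the disjointness of the arrow sets of
  a fundamental groupoid.\<close>

lemma path_class_eq_ends:
  assumes "path_class X p = path_class X q" "pathin X p"
  shows "p 0 = q 0" "p 1 = q 1"
proof -
  have "path_homotopic X q p"
    using path_class_self[OF assms(2)] unfolding assms(1) by (simp add: path_class_def)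
  then show "p 0 = q 0" "p 1 = q 1" by (rule path_homotopic_ends)+
qed

lemma objs_fundamental_groupoid [simp]: "objs (fundamental_groupoid X) = topspace X"
  by (simp add: fundamental_groupoid_def)

lemma ident_fundamental_groupoid [simp]:
  "ident (fundamental_groupoid X) x = path_class X (\<lambda>_. x)"
  by (simp add: fundamental_groupoid_def)

lemma arrows_fundamental_groupoid:
  "a \<in> arrows (fundamental_groupoid X) x y \<longleftrightarrow>
     (\<exists>p. a = path_class X p \<and> pathin X p \<and> p 0 = x \<and> p 1 = y)"
  by (auto simp: fundamental_groupoid_def)

lemma comp_arr_fundamental_groupoid:
  assumes "pathin X p" "pathin X q" "p 1 = q 0"
  shows "comp_arr (fundamental_groupoid X) (path_class X p) (path_class X q) =
    path_class X (path_concat p q)"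
proof -
  have "path_class X (path_concat p' q') = path_class X (path_concat p q)"
    if "p' \<in> path_class X p" "q' \<in> path_class X q" for p' q'
  proof -
    have "path_homotopic X p p'" "path_homotopic X q q'"
      using that by (simp_all add: path_class_def)
    then show ?thesis
      using assms(3) by (intro path_class_eqI[symmetric] path_homotopic_concat)
  qed
  then have "(\<Union>p'\<in>path_class X p. \<Union>q'\<in>path_class X q. path_class X (path_concat p' q')) =
      (\<Union>p'\<in>path_class X p. \<Union>q'\<in>path_class X q. path_class X (path_concat p q))"
    by (simp cong: SUP_cong)
  \<comment> \<open>A union of copies of one set is that set because both index classes are
    inhabited, by \<open>p\<close> and \<open>q\<close>.\<close>
  also have "\<dots> = path_class X (path_concat p q)"
    using path_class_self[OF assms(1)] path_class_self[OF assms(2)] by auto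
  finally show ?thesis
    by (simp add: fundamental_groupoid_def)
qed

lemma on_arrows_induced_map:
  assumes "continuous_map X Y f" "pathin X p"
  shows "on_arrows (induced_map Y f) (path_class X p) = path_class Y (f \<circ> p)"
proof -
  have "path_class Y (f \<circ> q) = path_class Y (f \<circ> p)" if "q \<in> path_class X p" for q
  proof -
    have "path_homotopic X p q" using that by (simp add: path_class_def)
    then show ?thesis
      using assms(1) by (intro path_class_eqI[symmetric] path_homotopic_compose)
  qed
  then have "(\<Union>q\<in>path_class X p. path_class Y (f \<circ> q)) =
      (\<Union>q\<in>path_class X p. path_class Y (f \<circ> p))"
    by (simp cong: SUP_cong)
  also have "\<dots> = path_class Y (f \<circ> p)"
    using path_class_self[OF assms(2)] by auto
  finally show ?thesis
    by (simp add: induced_map_def)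
qed

lemma on_objs_induced_map [simp]: "on_objs (induced_map Y f) = f"
  by (simp add: induced_map_def)

lemma pathin_compose: "pathin X p \<Longrightarrow> continuous_map X Y f \<Longrightarrow> pathin Y (f \<circ> p)"
  unfolding pathin_def by (rule continuous_map_compose)

section \<open>Groupoid axioms and functoriality\<close>

lemma is_groupoid_fundamental_groupoid: "is_groupoid (fundamental_groupoid X)"
proof -
  let ?G = "fundamental_groupoid X"
  note comp = comp_arr_fundamental_groupoid
  have "x = x' \<and> y = y'" if "arrows ?G x y \<inter> arrows ?G x' y' \<noteq> {}" for x y x' y'
    using that by (auto simp: arrows_fundamental_groupoid dest: path_class_eq_ends)
  moreover have "ident ?G x \<in> arrows ?G x x" if "x \<in> topspace X" for x
    using that by (auto simp: arrows_fundamental_groupoid pathin_const intro!: exI[of _ "\<lambda>_. x"])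
  moreover have "comp_arr ?G a b \<in> arrows ?G x z"
    if arr: "a \<in> arrows ?G x y" "b \<in> arrows ?G y z" for a b x y z
  proof -
    obtain p q where "a = path_class X p" "pathin X p" "p 0 = x" "p 1 = y"
        "b = path_class X q" "pathin X q" "q 0 = y" "q 1 = z"
      using arr unfolding arrows_fundamental_groupoid by blast
    then show ?thesis
      by (auto simp: comp arrows_fundamental_groupoid pathin_concat
          intro!: exI[of _ "path_concat p q"])
  qed
  moreover have "comp_arr ?G (ident ?G x) a = a \<and> comp_arr ?G a (ident ?G y) = a"
    if xy: "x \<in> topspace X" "y \<in> topspace X" and a: "a \<in> arrows ?G x y" for a x y
  proof -
    obtain p where p: "a = path_class X p" "pathin X p" "p 0 = x" "p 1 = y"
      using a unfolding arrows_fundamental_groupoid by blast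
    then show ?thesis
      using path_homotopic_concat_const_left[of X p] path_homotopic_concat_const_right[of X p] xy
      by (simp add: comp pathin_const path_class_eqI)
  qed
  moreover have "comp_arr ?G (comp_arr ?G a b) c = comp_arr ?G a (comp_arr ?G b c)"
    if arr: "a \<in> arrows ?G w x" "b \<in> arrows ?G x y" "c \<in> arrows ?G y z" for a b c w x y z
  proof -
    obtain p q r where "a = path_class X p" "pathin X p" "p 1 = x"
        "b = path_class X q" "pathin X q" "q 0 = x" "q 1 = y"
        "c = path_class X r" "pathin X r" "r 0 = y"
      using arr unfolding arrows_fundamental_groupoid by blast
    then show ?thesis
      using path_homotopic_concat_assoc[of X p q r]
      by (simp add: comp pathin_concat path_class_eqI)
  qed
  moreover have "\<exists>b \<in> arrows ?G y x. comp_arr ?G a b = ident ?G x \<and> comp_arr ?G b a = ident ?G y"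
    if arr: "a \<in> arrows ?G x y" for a x y
  proof -
    obtain p where p: "a = path_class X p" "pathin X p" "p 0 = x" "p 1 = y"
      using arr unfolding arrows_fundamental_groupoid by blast
    let ?r = "\<lambda>s. p (1 - s)"
    have r: "pathin X ?r" using p(2) by (rule pathin_reverse)
    have "path_class X ?r \<in> arrows ?G y x"
      using p r by (auto simp: arrows_fundamental_groupoid intro!: exI[of _ ?r])
    moreover have "comp_arr ?G a (path_class X ?r) = ident ?G x"
      using p r path_homotopic_concat_reverse[OF p(2)] by (simp add: comp path_class_eqI)
    \<comment> \<open>Reversing \<open>?r\<close> gives \<open>p\<close> back, so this is the
      previous cancellation applied to \<open>?r\<close>, which starts at \<open>y\<close>.\<close>
    moreover have "comp_arr ?G (path_class X ?r) a = ident ?G y"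
      using p r path_homotopic_concat_reverse[OF r] by (simp add: comp path_class_eqI)
    ultimately show ?thesis by blast
  qed
  ultimately show ?thesis
    unfolding is_groupoid_def objs_fundamental_groupoid by (intro conjI ballI impI) metis+
qed

text \<open>Composing with \<open>f\<close> sends constant paths to constant paths and commutes with
  \<open>path_concat\<close> exactly, so identities and composites are preserved already on
  representatives.\<close>

lemma groupoid_hom_induced_map:
  assumes f: "continuous_map X Y f"
  shows "groupoid_hom (fundamental_groupoid X) (fundamental_groupoid Y) (induced_map Y f)"
proof -
  let ?G = "fundamental_groupoid X" and ?G' = "fundamental_groupoid Y" and ?F = "induced_map Y f"
  have "f x \<in> topspace Y" if "x \<in> topspace X" for x
    using f that by (auto simp: continuous_map_def)
  moreover have "on_arrows ?F a \<in> arrows ?G' (f x) (f y)" if arr: "a \<in> arrows ?G x y" for a x y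
  proof -
    obtain p where "a = path_class X p" "pathin X p" "p 0 = x" "p 1 = y"
      using arr unfolding arrows_fundamental_groupoid by blast
    then show ?thesis
      unfolding arrows_fundamental_groupoid
      by (intro exI[of _ "f \<circ> p"]) (simp add: on_arrows_induced_map[OF f] pathin_compose[OF _ f])
  qed
  moreover have "on_arrows ?F (ident ?G x) = ident ?G' (f x)" if "x \<in> topspace X" for x
    using that by (simp add: on_arrows_induced_map[OF f] pathin_const o_def)
  moreover have "on_arrows ?F (comp_arr ?G a b) = comp_arr ?G' (on_arrows ?F a) (on_arrows ?F b)"
    if arr: "a \<in> arrows ?G x y" "b \<in> arrows ?G y z" for a b x y z
  proof -
    obtain p q where "a = path_class X p" "pathin X p" "p 1 = y"
        "b = path_class X q" "pathin X q" "q 0 = y"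
      using arr unfolding arrows_fundamental_groupoid by blast
    then show ?thesis
      by (simp add: comp_arr_fundamental_groupoid pathin_concat on_arrows_induced_map[OF f]
          compose_path_concat pathin_compose[OF _ f])
  qed
  ultimately show ?thesis
    unfolding groupoid_hom_def objs_fundamental_groupoid on_objs_induced_map
    using is_groupoid_fundamental_groupoid[of X] is_groupoid_fundamental_groupoid[of Y] by blast
qed

lemma induced_map_comp:
  assumes f: "continuous_map X Y f" and g: "continuous_map Y Z g"
    and a: "a \<in> arrows (fundamental_groupoid X) x y"
  shows "on_arrows (induced_map Z g) (on_arrows (induced_map Y f) a) =
    on_arrows (induced_map Z (g \<circ> f)) a"
proof -
  obtain p where p: "a = path_class X p" "pathin X p" "p 0 = x" "p 1 = y"
    using a unfolding arrows_fundamental_groupoid by blast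
  show ?thesis
    by (simp add: p(1) on_arrows_induced_map[OF f p(2)]
      on_arrows_induced_map[OF continuous_map_compose[OF f g] p(2)]
      on_arrows_induced_map[OF g pathin_compose[OF p(2) f]] o_assoc)
qed

text \<open>By \<open>induced_map_comp\<close>, each way around the square acts on arrows as the map
  induced by the common composite.\<close>

lemma groupoid_map_eq_on_induced_square:
  assumes f: "continuous_map X Y f" and g: "continuous_map Y Z g"
    and f': "continuous_map X Y' f'" and g': "continuous_map Y' Z g'"
    and eq: "g \<circ> f = g' \<circ> f'"
  shows "groupoid_map_eq_on (fundamental_groupoid X)
    (groupoid_map_comp (induced_map Z g) (induced_map Y f))
    (groupoid_map_comp (induced_map Z g') (induced_map Y' f'))"
proof -
  have "on_arrows (induced_map Z g) (on_arrows (induced_map Y f) a) =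
      on_arrows (induced_map Z g') (on_arrows (induced_map Y' f') a)"
    if "a \<in> arrows (fundamental_groupoid X) x y" for a x y
    unfolding induced_map_comp[OF f g that] induced_map_comp[OF f' g' that] eq ..
  moreover have "g (f x) = g' (f' x)" for x
    using eq by (metis comp_apply)
  ultimately show ?thesis
    unfolding groupoid_map_eq_on_def groupoid_map_comp_def groupoid_map.simps comp_apply
      on_objs_induced_map
    by blast
qed

section \<open>The square of configuration spaces\<close>

lemma continuous_map_conf_proj:
  "continuous_map (conf_space M k) (unordered_conf_space M k) (conf_proj k)"
  unfolding unordered_conf_space_def
  by (rule quotient_imp_continuous_map[OF quotient_map_quotient_topology])

lemma continuous_map_hyperdigraph_proj:
  "continuous_map (hyperdigraph_space M H k) (hypergraph_space M H k) (conf_proj k)"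
  unfolding hyperdigraph_space_def hypergraph_space_def underlying_hypergraph_def
  by (auto simp: continuous_map_in_subtopology
      intro: continuous_map_from_subtopology continuous_map_conf_proj)

theorem proposition6p1:
  fixes M :: "'a topology" and H :: "nat \<Rightarrow> (nat \<Rightarrow> 'a) set"
  assumes "connected_space M" and "surface M" and "hyperdigraph M H"
  shows "\<exists>\<Phi> \<Psi>.
    graded_groupoid_hom (\<lambda>k. fundamental_groupoid (hyperdigraph_space M H k))
      (braid_groupoid M) \<Phi> \<and>
    graded_groupoid_hom (\<lambda>k. fundamental_groupoid (hypergraph_space M H k))
      (pure_braid_groupoid M) \<Psi> \<and>
    (\<forall>k\<ge>1. \<Phi> k = induced_map (conf_space M k) (\<lambda>x. x) \<and>
            \<Psi> k = induced_map (unordered_conf_space M k) (\<lambda>x. x)) \<and>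
    (\<forall>k\<ge>1. groupoid_map_eq_on (fundamental_groupoid (hyperdigraph_space M H k))
       (groupoid_map_comp (induced_map (unordered_conf_space M k) (conf_proj k)) (\<Phi> k))
       (groupoid_map_comp (\<Psi> k) (induced_map (hypergraph_space M H k) (conf_proj k))))"
proof -
  have i: "continuous_map (hyperdigraph_space M H k) (conf_space M k) (\<lambda>x. x)" for k
    unfolding hyperdigraph_space_def by (simp add: continuous_map_from_subtopology)
  have j: "continuous_map (hypergraph_space M H k) (unordered_conf_space M k) (\<lambda>x. x)" for k
    unfolding hypergraph_space_def by (simp add: continuous_map_from_subtopology)
  let ?\<Phi> = "\<lambda>k. induced_map (conf_space M k) (\<lambda>x. x)"
  let ?\<Psi> = "\<lambda>k. induced_map (unordered_conf_space M k) (\<lambda>x. x)"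
  have "groupoid_map_eq_on (fundamental_groupoid (hyperdigraph_space M H k))
       (groupoid_map_comp (induced_map (unordered_conf_space M k) (conf_proj k)) (?\<Phi> k))
       (groupoid_map_comp (?\<Psi> k) (induced_map (hypergraph_space M H k) (conf_proj k)))" for k
    \<comment> \<open>Include then project along one side, project then include along the other: as
      functions both composites are \<open>conf_proj k\<close>.\<close>
    by (rule groupoid_map_eq_on_induced_square
        [OF i continuous_map_conf_proj continuous_map_hyperdigraph_proj j]) (simp add: fun_eq_iff)
  then show ?thesis
    by (intro exI[of _ ?\<Phi>] exI[of _ ?\<Psi>])
      (simp only: graded_groupoid_hom_def braid_groupoid_def pure_braid_groupoid_def
        groupoid_hom_induced_map i j, simp)
qed

end
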